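(* Let $a,b,c\geq 1$ be integers, let $v=2(a+b+c)+1$, let $t$ be an integer with $2<t\leq \frac{v-1}{2}$, and let $L=\{1^a,2^b,t^c\}$. Let $r'$ be the remainder of the division of $v$ by $2t$. Assume that $a+b\geq \frac{r'-1}{2}$ if $\left\lfloor\frac{v}{t}\right\rfloor$ is even, and that $a+b\geq t-\frac{r'+1}{2}$ if $\left\lfloor\frac{v}{t}\right\rfloor$ is odd. Then there exists a near $1$-factor $F$ of $K_v$ such that $\ell(F)=L$.
   Context: $K_v$ denotes the complete graph on the vertex set $\{0,1,\dots,v-1\}$. The length of an edge $[x,y]$ of $K_v$ is $\ell(x,y)=\min(|x-y|,\,v-|x-y|)$. For a subgraph $\Gamma$ of $K_v$, $\ell(\Gamma)$ is the multiset (list) of the lengths of all edges of $\Gamma$, taken with multiplicity. A near $1$-factor of $K_{2n+1}$ is a subgraph consisting of $n$ pairwise disjoint edges and one isolated vertex. "List" means multiset; $\{1^a,2^b,t^c\}$ denotes the list containing $a$ copies of $1$, $b$ copies of $2$ and $c$ copies of $t$. *)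

theory Defs
  imports Complex_Main "HOL-Library.Multiset" "HOL-Library.Disjoint_Sets"
begin

type_synonym graph = "nat set \<times> nat set set"

definition verts :: "graph \<Rightarrow> nat set" where
  "verts G = fst G"

definition edges :: "graph \<Rightarrow> nat set set" where
  "edges G = snd G"

definition complete_graph :: "nat \<Rightarrow> graph" where
  "complete_graph v = ({..<v}, {{x, y} | x y. x < v \<and> y < v \<and> x \<noteq> y})"

definition is_subgraph :: "graph \<Rightarrow> graph \<Rightarrow> bool" where
  "is_subgraph G H \<longleftrightarrow>
     verts G \<subseteq> verts H \<and> edges G \<subseteq> edges H \<and> \<Union> (edges G) \<subseteq> verts G"

definition vertex_dist :: "nat \<Rightarrow> nat \<Rightarrow> nat \<Rightarrow> int" where
  "vertex_dist v x y = min \<bar>int x - int y\<bar> (int v - \<bar>int x - int y\<bar>)"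

text \<open>The length depends only on the unordered pair, so the endpoints of an edge may be
  taken in increasing order; see \<open>edge_length_doubleton\<close>.\<close>

definition edge_length :: "nat \<Rightarrow> nat set \<Rightarrow> int" where
  "edge_length v e = vertex_dist v (Min e) (Max e)"

lemma edge_length_doubleton: "edge_length v {x, y} = vertex_dist v x y"
  by (cases x y rule: linorder_cases) (simp_all add: edge_length_def vertex_dist_def)

definition length_list :: "nat \<Rightarrow> graph \<Rightarrow> int multiset" where
  "length_list v G = image_mset (edge_length v) (mset_set (edges G))"

definition near_one_factor :: "nat \<Rightarrow> graph \<Rightarrow> bool" where
  "near_one_factor n F \<longleftrightarrow>
     is_subgraph F (complete_graph (2 * n + 1)) \<and>
     card (edges F) = n \<and> disjoint (edges F) \<and>
     (\<exists>w. w \<notin> \<Union> (edges F) \<and> verts F = insert w (\<Union> (edges F)))"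

end

theory Submission
  imports Defs
begin

text \<open>Everything happens on the line \<open>0, \<dots>, v - 1\<close>; no edge wraps around. Write \<open>c = s t + c'\<close>
  with \<open>c' < t\<close>. The last \<open>2 t s\<close> points split into blocks of length \<open>2 t\<close>, each of which is
  matched by \<open>t\<close> edges of length \<open>t\<close>. On the remaining \<open>N = 2 (a + b + c') + 1\<close> points the
  hypothesis says that \<open>c' = 0\<close> or \<open>N \<ge> t + c'\<close>. In the latter case the edges \<open>{i, i + t}\<close> with
  \<open>i < c'\<close> leave two gaps, one of even and one of odd size. An even gap can be matched with lengths
  1 and 2 using any even number of 2s, an odd gap (missing one point) using any number of 2s.
  This suffices unless the odd gap is a single point and \<open>b\<close> is odd; then shifting one of the
  edges of length \<open>t\<close> by one creates an additional edge of length 2.\<close>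

section \<open>Perfect matchings of sets of naturals with prescribed differences\<close>

inductive matched :: "nat set \<Rightarrow> nat multiset \<Rightarrow> bool" where
  empty: "matched {} {#}"
| insert: "matched S D \<Longrightarrow> x \<notin> S \<Longrightarrow> x + d \<notin> S \<Longrightarrow> d > 0 \<Longrightarrow>
    matched (insert x (insert (x + d) S)) (add_mset d D)"

lemma matched_union:
  assumes "matched S D" "matched S' D'" "S \<inter> S' = {}"
  shows "matched (S \<union> S') (D + D')"
  using assms
proof (induction rule: matched.induct)
  case empty
  then show ?case by simp
next
  case (insert S D x d)
  then have "matched (insert x (insert (x + d) (S \<union> S'))) (add_mset d (D + D'))"
    by (intro matched.insert) auto
  then show ?case by simp
qed

lemma matched_edge: "d > 0 \<Longrightarrow> y = x + d \<Longrightarrow> matched {x, y} {#d#}"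
  using matched.insert[OF matched.empty, of x d] by simp

text \<open>The bound \<open>k \<le> t\<close> keeps the two runs apart, so the edges
  \<open>{i, i + t}\<close> never meet. Taking \<open>k = t\<close> makes the runs adjacent and
  yields a full block.\<close>

lemma matched_translate:
  assumes "k \<le> t" "0 < t"
  shows "matched ({x..<x + k} \<union> {x + t..<x + t + k}) (replicate_mset k t)"
  using assms
proof (induction k)
  case 0
  then show ?case by (simp add: matched.empty)
next
  case (Suc k)
  have "matched ({x + k, x + k + t} \<union> ({x..<x + k} \<union> {x + t..<x + t + k}))
      ({#t#} + replicate_mset k t)"
    using Suc by (intro matched_union matched_edge) auto
  moreover have "{x + k, x + k + t} \<union> ({x..<x + k} \<union> {x + t..<x + t + k}) =
      {x..<x + Suc k} \<union> {x + t..<x + t + Suc k}"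
    by auto
  ultimately show ?case by simp
qed

lemma matched_blocks:
  assumes "0 < t"
  shows "matched {x..<x + 2 * t * s} (replicate_mset (s * t) t)"
proof (induction s)
  case 0
  then show ?case by (simp add: matched.empty)
next
  case (Suc s)
  let ?y = "x + 2 * t * s"
  have "matched ({?y..<?y + t} \<union> {?y + t..<?y + t + t} \<union> {x..<?y})
      (replicate_mset t t + replicate_mset (s * t) t)"
    using assms Suc by (intro matched_union matched_translate) auto
  moreover have "{?y..<?y + t} \<union> {?y + t..<?y + t + t} \<union> {x..<?y} = {x..<x + 2 * t * Suc s}"
    by auto
  moreover have "replicate_mset t t + replicate_mset (s * t) t = replicate_mset (Suc s * t) t"
    by (auto simp: multiset_eq_iff)
  ultimately show ?case by simp
qed

abbreviation ones_twos :: "nat \<Rightarrow> nat \<Rightarrow> nat multiset" where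
  "ones_twos a b \<equiv> replicate_mset a 1 + replicate_mset b 2"

text \<open>Ones fill blocks of two points, while 2s come in crossing pairs that fill blocks of four
  points; hence the parity condition on \<open>b\<close>.\<close>

lemma matched_even_interval:
  assumes "even b" "y = x + 2 * (a + b)"
  shows "matched {x..<y} (ones_twos a b)"
proof -
  obtain k where k: "b = k * 2" using assms(1) by (metis dvdE mult.commute)
  have "matched ({x..<x + 2 * 1 * a} \<union> {x + 2 * a..<x + 2 * a + 2 * 2 * k})
      (replicate_mset (a * 1) 1 + replicate_mset (k * 2) 2)"
    by (intro matched_union matched_blocks) auto
  moreover have "{x..<x + 2 * 1 * a} \<union> {x + 2 * a..<x + 2 * a + 2 * 2 * k} = {x..<y}"
    using k assms(2) by auto
  ultimately show ?thesis using k by simp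
qed

section \<open>Matchings that leave exactly one point free\<close>

definition near_matched :: "nat set \<Rightarrow> nat multiset \<Rightarrow> bool" where
  "near_matched S D \<longleftrightarrow> (\<exists>h\<in>S. matched (S - {h}) D)"

lemma near_matchedI:
  "matched R D \<Longrightarrow> h \<notin> R \<Longrightarrow> S = insert h R \<Longrightarrow> near_matched S D"
  by (auto simp: near_matched_def)

lemma near_matched_union:
  assumes "near_matched S D" "matched S' D'" "S \<inter> S' = {}"
  shows "near_matched (S \<union> S') (D + D')"
proof -
  from assms(1) obtain h where h: "h \<in> S" "matched (S - {h}) D"
    by (auto simp: near_matched_def)
  show ?thesis
    using matched_union[OF h(2) assms(2)] h(1) assms(3)
    by (intro near_matchedI[of "(S - {h}) \<union> S'" _ h]) auto
qed

text \<open>The free point absorbs the parity: when \<open>b\<close> is odd, one edge of length 2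
  spans it.\<close>

lemma near_matched_odd_interval:
  assumes "y = x + 2 * (a + b) + 1"
  shows "near_matched {x..<y} (ones_twos a b)"
proof (cases "even b")
  case True
  have "matched {x + 1..<y} (ones_twos a b)"
    using True assms by (intro matched_even_interval) auto
  then show ?thesis
    by (rule near_matchedI[of _ _ x]) (use assms in auto)
next
  case False
  then obtain k where k: "b = Suc k" "even k"
    by (metis even_Suc odd_pos Suc_pred')
  have "matched ({x, x + 2} \<union> {x + 3..<y}) ({#2#} + ones_twos a k)"
    using k assms by (intro matched_union matched_edge matched_even_interval) auto
  then have "matched ({x, x + 2} \<union> {x + 3..<y}) (ones_twos a b)"
    by (simp add: k)
  then show ?thesis
    by (rule near_matchedI[of _ _ "x + 1"]) (use assms k in auto)
qed

text \<open>Here \<open>p\<close> is the number of 2s placed in an even gap holding \<open>g\<close>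
  edges; the other \<open>b - p\<close> go to an odd gap holding \<open>h\<close> edges. The least
  even \<open>p\<close> with \<open>b \<le> p + h\<close> works: if \<open>b > h\<close>, then
  \<open>b - h = g - a < g\<close> leaves room to round up to an even number, and
  \<open>h \<ge> 1\<close> keeps the result at most \<open>b\<close>.\<close>

lemma even_summand:
  fixes a b g h :: nat
  assumes "a + b = g + h" "a \<ge> 1" "even b \<or> h \<ge> 1"
  obtains p where "even p" "p \<le> b" "p \<le> g" "b \<le> p + h"
proof (cases "b \<le> h")
  case True
  then show ?thesis using that[of 0] by simp
next
  case False
  show ?thesis
  proof (cases "even (b - h)")
    case True
    then show ?thesis using that[of "b - h"] assms False by linarith
  next
    case odd: False
    then have "h \<ge> 1" using assms(3) by (cases "h = 0") auto
    moreover have "even (b - h + 1)" using odd by simp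
    ultimately show ?thesis using that[of "b - h + 1"] assms False odd by fastforce
  qed
qed

lemma near_matched_two_intervals:
  assumes "a + b = g + h" "a \<ge> 1" "even b \<or> h \<ge> 1"
    and "y = x + (2 * h + 1)" "y' = x' + 2 * g" "{x..<y} \<inter> {x'..<y'} = {}"
  shows "near_matched ({x..<y} \<union> {x'..<y'}) (ones_twos a b)"
proof -
  from even_summand[OF assms(1-3)] obtain p where
    p: "even p" "p \<le> b" "p \<le> g" "b \<le> p + h" .
  have "near_matched ({x..<y} \<union> {x'..<y'})
      (ones_twos (p + h - b) (b - p) + ones_twos (g - p) p)"
    using p assms
    by (intro near_matched_union near_matched_odd_interval matched_even_interval) auto
  moreover have "ones_twos (p + h - b) (b - p) + ones_twos (g - p) p = ones_twos a b"
    using p assms(1) by (auto simp: multiset_eq_iff)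
  ultimately show ?thesis by simp
qed

lemma near_matched_initial:
  fixes a b c t N :: nat
  assumes "a \<ge> 1" "1 \<le> c" "c < t" "N = 2 * (a + b + c) + 1" "t + c \<le> N"
  shows "near_matched {0..<N} (ones_twos a b + replicate_mset c t)"
proof -
  let ?E = "{0..<0 + c} \<union> {0 + t..<0 + t + c}"
  have E: "matched ?E (replicate_mset c t)"
    using assms by (intro matched_translate) auto
  have gaps: ?thesis if "near_matched ({c..<t} \<union> {t + c..<N}) (ones_twos a b)"
  proof -
    have "near_matched ({c..<t} \<union> {t + c..<N} \<union> ?E) (ones_twos a b + replicate_mset c t)"
      using assms by (intro near_matched_union[OF that E]) auto
    moreover have "{c..<t} \<union> {t + c..<N} \<union> ?E = {0..<N}"
      using assms by auto
    ultimately show ?thesis by simp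
  qed
  obtain k where k: "odd b \<Longrightarrow> b = Suc k \<and> even k"
    by (metis even_Suc odd_pos Suc_pred')
  show ?thesis
  proof (cases "odd (t - c)")
    case True
    then obtain h where h: "t - c = 2 * h + 1" by (rule oddE)
    show ?thesis
    proof (cases "even b \<or> h \<ge> 1")
      case True
      have "near_matched ({c..<t} \<union> {t + c..<N}) (ones_twos a b)"
        using h assms True
        by (intro near_matched_two_intervals[where h = h and g = "a + b - h"]) auto
      then show ?thesis by (rule gaps)
    next
      case False
      \<comment> \<open>The odd gap is the point \<open>c\<close>. Moving
        \<open>{c - 1, 2 * c}\<close> to \<open>{c, c + t}\<close> frees \<open>c - 1\<close>, which
        stays unmatched, and \<open>2 * c\<close>, which is joined to \<open>2 * c + 2\<close>. An
        even number \<open>k\<close> of 2s remains.\<close>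
      then have kb: "b = Suc k" "even k" and t: "t = Suc c" using k h assms by auto
      let ?F = "{0..<0 + (c - 1)} \<union> {0 + t..<0 + t + (c - 1)}"
      let ?R = "{2 * c, 2 * c + 2} \<union> ({c, c + t} \<union> (?F \<union> {2 * c + 3..<N}))"
      have "matched ?R
          ({#2#} + ({#t#} + (replicate_mset (c - 1) t + ones_twos a k)))"
        using assms kb t
        by (intro matched_union matched_edge matched_translate matched_even_interval) auto
      moreover have "{#2#} + ({#t#} + (replicate_mset (c - 1) t + ones_twos a k)) =
          ones_twos a b + replicate_mset c t"
        using assms(2) kb by (cases c) auto
      moreover have "{0..<N} = insert (c - 1) ?R"
        using assms t kb by auto
      moreover have "c - 1 \<notin> ?R"
        using assms t by auto
      ultimately show ?thesis
        using near_matchedI by metis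
    qed
  next
    case False
    then obtain g where g: "t - c = 2 * g" using evenE by blast
    define h where "h = a + b - g"
    have h: "N = t + c + (2 * h + 1)" "a + b = g + h"
      using assms g by (auto simp: h_def)
    show ?thesis
    proof (cases "even b \<or> h \<ge> 1")
      case True
      have "near_matched ({t + c..<N} \<union> {c..<t}) (ones_twos a b)"
        using h g assms True
        by (intro near_matched_two_intervals[where h = h and g = g]) auto
      then show ?thesis by (intro gaps) (simp add: Un_commute)
    next
      case False
      \<comment> \<open>Now the odd gap is the last point \<open>t + c\<close>. The same shift of
        \<open>{c - 1, t + c - 1}\<close> frees \<open>c - 1\<close>, joined to
        \<open>c + 1\<close>, and leaves \<open>t + c - 1\<close> unmatched.\<close>
      then have kb: "b = Suc k" "even k" and N: "N = t + c + 1" and t: "t = c + 2 * (a + b)"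
        using k h g assms by auto
      let ?F = "{0..<0 + (c - 1)} \<union> {0 + t..<0 + t + (c - 1)}"
      let ?R = "{c - 1, c + 1} \<union> ({c, c + t} \<union> (?F \<union> {c + 2..<t}))"
      have "matched ?R
          ({#2#} + ({#t#} + (replicate_mset (c - 1) t + ones_twos a k)))"
        using assms(1-3) kb t
        by (intro matched_union matched_edge matched_translate matched_even_interval) auto
      moreover have "{#2#} + ({#t#} + (replicate_mset (c - 1) t + ones_twos a k)) =
          ones_twos a b + replicate_mset c t"
        using assms(2) kb by (cases c) auto
      moreover have "{0..<N} = insert (t + c - 1) ?R"
        using assms(1-3) t kb N by auto
      moreover have "t + c - 1 \<notin> ?R"
        using assms(1-3) t kb by auto
      ultimately show ?thesis
        using near_matchedI by metis
    qed
  qed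
qed

section \<open>From matchings to near 1-factors\<close>

lemma matched_edge_set:
  assumes "matched S D"
  shows "\<exists>E. finite E \<and> disjoint E \<and> \<Union>E = S \<and> (\<forall>e\<in>E. \<exists>x y. x \<noteq> y \<and> e = {x, y}) \<and>
    image_mset (\<lambda>e. Max e - Min e) (mset_set E) = D"
  using assms
proof (induction rule: matched.induct)
  case empty
  then show ?case by (intro exI[of _ "{}"]) auto
next
  case (insert S D x d)
  then obtain E where E: "finite E" "disjoint E" "\<Union>E = S"
    "\<forall>e\<in>E. \<exists>x y. x \<noteq> y \<and> e = {x, y}" "image_mset (\<lambda>e. Max e - Min e) (mset_set E) = D"
    by blast
  \<comment> \<open>Freshness of the edge ensures that \<open>mset_set\<close> counts its difference
    separately.\<close>
  have new: "{x, x + d} \<notin> E" using E(3) insert.hyps by auto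
  have "disjoint (insert {x, x + d} E)"
    using E(2,3) insert.hyps unfolding disjoint_def by auto
  moreover have "\<exists>u w. u \<noteq> w \<and> {x, x + d} = {u, w}"
    using insert.hyps by (intro exI[of _ x] exI[of _ "x + d"]) auto
  ultimately show ?case
    using E new by (intro exI[of _ "insert {x, x + d} E"]) auto
qed

text \<open>The bound \<open>2 * d \<le> v\<close> makes the cyclic length of each edge equal to its
  plain difference; the unmatched point becomes the isolated vertex.\<close>

lemma near_one_factor_of_near_matched:
  fixes n v :: nat and D :: "nat multiset"
  assumes "near_matched {0..<v} D" "v = 2 * n + 1" "size D = n" "\<And>d. d \<in># D \<Longrightarrow> 2 * d \<le> v"
  shows "\<exists>F. near_one_factor n F \<and> length_list v F = image_mset int D"
proof -
  obtain h where h: "h \<in> {0..<v}" "matched ({0..<v} - {h}) D"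
    using assms(1) by (auto simp: near_matched_def)
  obtain E where E: "finite E" "disjoint E" "\<Union>E = {0..<v} - {h}"
    "\<forall>e\<in>E. \<exists>x y. x \<noteq> y \<and> e = {x, y}" "image_mset (\<lambda>e. Max e - Min e) (mset_set E) = D"
    using matched_edge_set[OF h(2)] by blast
  have "card E = n"
    using arg_cong[OF E(5), of size] assms(3) by simp
  have "e \<in> snd (complete_graph v)" if e: "e \<in> E" for e
  proof -
    obtain x y where "x \<noteq> y" "e = {x, y}" using E(4) e by blast
    moreover have "e \<subseteq> {0..<v}" using E(3) e by blast
    ultimately show ?thesis by (auto simp: complete_graph_def)
  qed
  then have "E \<subseteq> snd (complete_graph v)" by blast
  moreover have "{0..<v} = insert h (\<Union>E)" "h \<notin> \<Union>E"
    unfolding E(3) using h(1) by auto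
  moreover have "{0..<v} \<subseteq> fst (complete_graph v)"
    by (auto simp: complete_graph_def)
  ultimately have "near_one_factor n ({0..<v}, E)"
    unfolding near_one_factor_def is_subgraph_def verts_def edges_def fst_conv snd_conv
      assms(2)[symmetric]
    using E(2) \<open>card E = n\<close> by blast
  moreover have "edge_length v e = int (Max e - Min e)" if e: "e \<in> E" for e
  proof -
    have "Max e - Min e \<in># D" using E(1) e by (subst E(5)[symmetric]) auto
    then have "2 * (Max e - Min e) \<le> v" by (rule assms(4))
    moreover have "Min e \<le> Max e" using E(4) e by (auto simp: min_def max_def)
    ultimately show ?thesis
      by (auto simp: edge_length_def vertex_dist_def min_def of_nat_diff)
  qed
  then have "length_list v ({0..<v}, E) = image_mset int D"
    using E(1) by (subst E(5)[symmetric])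
      (auto simp: length_list_def edges_def multiset.map_comp intro!: image_mset_cong)
  ultimately show ?thesis by blast
qed

theorem proposition21:
  fixes a b c v r' :: nat and t :: int and L :: "int multiset"
  assumes "a \<ge> 1" and "b \<ge> 1" and "c \<ge> 1"
    and "v = 2 * (a + b + c) + 1"
    and "2 < t" and "real_of_int t \<le> (real v - 1) / 2"
    and "L = replicate_mset a 1 + replicate_mset b 2 + replicate_mset c t"
    and "int r' = int v mod (2 * t)"
    and "even \<lfloor>real v / real_of_int t\<rfloor> \<Longrightarrow> real (a + b) \<ge> (real r' - 1) / 2"
    and "odd \<lfloor>real v / real_of_int t\<rfloor> \<Longrightarrow>
           real (a + b) \<ge> real_of_int t - (real r' + 1) / 2"
  shows "\<exists>F. near_one_factor (a + b + c) F \<and> length_list v F = L"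
proof -
  obtain \<tau> where t: "t = int \<tau>" using \<open>2 < t\<close> by (cases t) auto
  have \<tau>: "2 < \<tau>" "2 * \<tau> \<le> v" using assms(4-6) t by auto
  have "\<lfloor>real v / real_of_int t\<rfloor> = int (v div \<tau>)"
    by (simp add: t floor_divide_of_nat_eq)
  then have even_case: "r' \<le> 2 * (a + b) + 1" if "even (v div \<tau>)"
    using assms(9) that by simp
  have odd_case: "2 * \<tau> \<le> 2 * (a + b) + r' + 1" if "odd (v div \<tau>)"
  proof -
    have "real (2 * \<tau>) \<le> real (2 * (a + b) + r' + 1)"
      using assms(10) that \<open>\<lfloor>real v / real_of_int t\<rfloor> = int (v div \<tau>)\<close> t
      by (simp add: field_simps)
    then show ?thesis by (simp only: of_nat_le_iff)
  qed
  define s c' N where "s = c div \<tau>" and "c' = c mod \<tau>" and "N = 2 * (a + b + c') + 1"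
  have c: "c = s * \<tau> + c'" "c' < \<tau>" using \<tau> by (auto simp: s_def c'_def)
  have v: "v = N + 2 * \<tau> * s" using assms(4) c(1) by (simp add: N_def)
  have "int r' = int (v mod (2 * \<tau>))" using assms(8) t by (simp add: zmod_int)
  then have r': "r' = N mod (2 * \<tau>)" using v by simp
  \<comment> \<open>Removing the blocks lowers the quotient by \<open>2 * s\<close>, which preserves
    its parity.\<close>
  have div: "even (v div \<tau>) \<longleftrightarrow> even (N div \<tau>)"
    using v \<tau> by (simp add: mult.assoc mult.left_commute[of 2])
  \<comment> \<open>If \<open>N \<ge> 2 * \<tau>\<close>, then \<open>c' < \<tau>\<close> suffices.
    Otherwise \<open>r' = N\<close>, and since \<open>2 * (a + b) + 1 = N - 2 * c'\<close>, the even
    case forces \<open>c' = 0\<close> and the odd case reads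
    \<open>2 * \<tau> \<le> 2 * N - 2 * c'\<close>.\<close>
  have N: "c' = 0 \<or> \<tau> + c' \<le> N"
  proof (cases "N < 2 * \<tau>")
    case True
    then have "r' = N" using r' by simp
    show ?thesis
    proof (cases "even (v div \<tau>)")
      case True
      then show ?thesis using even_case \<open>r' = N\<close> by (simp add: N_def)
    next
      case False
      then show ?thesis using odd_case \<open>r' = N\<close> by (simp add: N_def)
    qed
  qed (use c(2) in auto)
  have "near_matched {0..<N} (ones_twos a b + replicate_mset c' \<tau>)"
  proof (cases "c' = 0")
    case True
    then show ?thesis using near_matched_odd_interval[of N 0 a b] by (simp add: N_def)
  next
    case False
    then show ?thesis using N c(2) \<open>a \<ge> 1\<close> N_def by (intro near_matched_initial) auto
  qed
  then have "near_matched ({0..<N} \<union> {N..<N + 2 * \<tau> * s})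
      (ones_twos a b + replicate_mset c' \<tau> + replicate_mset (s * \<tau>) \<tau>)"
    using \<tau> by (intro near_matched_union matched_blocks) auto
  moreover have "{0..<N} \<union> {N..<N + 2 * \<tau> * s} = {0..<v}" using v by auto
  moreover have "ones_twos a b + replicate_mset c' \<tau> + replicate_mset (s * \<tau>) \<tau> =
      ones_twos a b + replicate_mset c \<tau>"
    using c(1) by (auto simp: multiset_eq_iff)
  ultimately have "near_matched {0..<v} (ones_twos a b + replicate_mset c \<tau>)" by metis
  then have "\<exists>F. near_one_factor (a + b + c) F \<and>
      length_list v F = image_mset int (ones_twos a b + replicate_mset c \<tau>)"
    by (rule near_one_factor_of_near_matched) (use assms(4) \<tau> in \<open>auto split: if_splits\<close>)
  then show ?thesis using assms(7) t by simp
qed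

end
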